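(* Let $\langle A_s\rangle_{s\in\omega^{<\omega}}$ and $\langle A'_s\rangle_{s\in\omega^{<\omega}}$ be tree partitions of $\omega$. There are a bijection $\sigma:\omega\to\omega$ and a level-preserving tree isomorphism (a bijection preserving length and initial segments) $\tau:\omega^{<\omega}\to\omega^{<\omega}$ such that $\sigma[A_s]=A'_{\tau(s)}$ for every $s$. Moreover $\sigma$ can be chosen so that all successor permutations of the induced $\tau$ have finite support: for every node $t$, the permutation $\pi_t$ of $\omega$ determined by $\tau(t^\frown n)=\tau(t)^\frown\pi_t(n)$ moves only finitely many points. Consequently, the ideals $\mathcal H^{\mathcal J}_\alpha$ (for every proper ideal $\mathcal J\supseteq\mathrm{Fin}$ on $\omega$ and every $\alpha<\omega_1$), $\mathcal G_k$ ($k\ge2$), $\mathcal C$, $\mathcal{PC}$, $\mathcal{ED}_m$ ($m<\omega$), and the quotient $\mathcal P(\omega)/\mathcal H$, do not depend on the chosen tree partition, up to an isomorphism induced by a bijection of $\omega$: if $\mathcal I$ and $\mathcal I'$ are the ideals of one of these kinds computed from $\langle A_s\rangle$ and from $\langle A'_s\rangle$, there is a bijection $\rho$ of $\omega$ with $X\in\mathcal I\iff\rho[X]\in\mathcal I'$ for all $X\subseteq\omega$; and there is a bijection of $\omega$ inducing an isomorphism between the quotients $\mathcal P(\omega)/\mathcal H$ computed from the two partitions.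
   Context: A tree partition of $\omega$ is a family $\langle A_s:s\in\omega^{<\omega}\rangle$ of infinite subsets of $\omega$ such that $A_\varnothing=\omega$, for each $s$ the family $\{A_{s^\frown n}:n\in\omega\}$ is a partition of $A_s$, and any two distinct points of $\omega$ lie in different cells $A_s\neq A_t$ with $|s|=|t|=n$ for some $n$. For $x\in\omega$, $b_x\in\omega^\omega$ is the unique branch with $x\in A_{b_x\upharpoonright n}$ for all $n$; for $x\ne y$, $\Delta(x,y)=\min\{n:b_x(n)\ne b_y(n)\}$. For $X\subseteq\omega$: $T_X=\{s:X\cap A_s\ne\varnothing\}$, $T^\infty_X=\{s:X\cap A_s\text{ infinite}\}$. Ideals "generated by" a family are understood to contain all finite sets. For $T\subseteq\omega^{<\omega}$, $\mathrm{Succ}_T(s)=\{n:s^\frown n\in T\}$. Derived ideals: $D_{\mathcal J}(T)=\{s\in T:\mathrm{Succ}_T(s)\notin\mathcal J\}$; $D^0_{\mathcal J}(T)=T$, $D^{\alpha+1}_{\mathcal J}(T)=D_{\mathcal J}(D^\alpha_{\mathcal J}(T))$, intersections at limits; $\mathcal H^{\mathcal J}_\alpha=\{X\subseteq\omega:\varnothing\notin D^\alpha_{\mathcal J}(T^\infty_X)\}$; $\mathcal H=\bigcup_{\alpha<\omega_1}\mathcal H^{\mathrm{Fin}}_\alpha$. $\mathcal G_k$ is generated by the sets $H\subseteq\omega$ on which $c_k(\{x,y\})=\Delta(x,y)\bmod k$ is constant on pairs. $\mathcal C=\{X:[T^\infty_X]\text{ is countable}\}$, where $[T]$ is the set of infinite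 branches of $T$. A selector is a set contained in some $A_s$ with exactly one point in each $A_{s^\frown n}$, $n\in\omega$. $\mathcal{ED}_m$ is generated by $\{A_t:t\in\omega^{m+1}\}$ together with all selectors. $\mathcal{PC}$ is generated by the selectors and the sets $X$ with $|\mathrm{Succ}_{T_X}(s)|\le|s|+1$ for every $s\in T_X$. *)

theory Defs
  imports "HOL-Library.Sublist" "HOL-Library.Countable_Set" "HOL-Library.Disjoint_Sets"
begin

section \<open>Tree partitions\<close>

text \<open>Nodes of $\omega^{<\omega}$ are lists over \<^typ>\<open>nat\<close>, and $s^\frown n$ is \<^term>\<open>s @ [n]\<close>.\<close>

definition tree_partition :: "(nat list \<Rightarrow> nat set) \<Rightarrow> bool" where
  "tree_partition A \<longleftrightarrow>
     A [] = UNIV \<and>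
     (\<forall>s. infinite (A s)) \<and>
     (\<forall>s. disjoint_family (\<lambda>n. A (s @ [n])) \<and> (\<Union>n. A (s @ [n])) = A s) \<and>
     (\<forall>x y. x \<noteq> y \<longrightarrow>
        (\<exists>s t. length s = length t \<and> x \<in> A s \<and> y \<in> A t \<and> A s \<noteq> A t))"

definition restr :: "(nat \<Rightarrow> nat) \<Rightarrow> nat \<Rightarrow> nat list" where
  "restr b n = map b [0..<n]"

text \<open>For a tree partition the branch exists and is unique, so \<open>branch_of\<close> is well defined;
  \<open>Delta A x y\<close> is meaningful for \<open>x \<noteq> y\<close> only.\<close>

definition branch_of :: "(nat list \<Rightarrow> nat set) \<Rightarrow> nat \<Rightarrow> nat \<Rightarrow> nat" where
  "branch_of A x = (THE b. \<forall>n. x \<in> A (restr b n))"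

definition Delta :: "(nat list \<Rightarrow> nat set) \<Rightarrow> nat \<Rightarrow> nat \<Rightarrow> nat" where
  "Delta A x y = (LEAST n. branch_of A x n \<noteq> branch_of A y n)"

definition tree_of :: "(nat list \<Rightarrow> nat set) \<Rightarrow> nat set \<Rightarrow> nat list set" where
  "tree_of A X = {s. X \<inter> A s \<noteq> {}}"

definition inf_tree_of :: "(nat list \<Rightarrow> nat set) \<Rightarrow> nat set \<Rightarrow> nat list set" where
  "inf_tree_of A X = {s. infinite (X \<inter> A s)}"

definition Succ_in :: "nat list set \<Rightarrow> nat list \<Rightarrow> nat set" where
  "Succ_in T s = {n. s @ [n] \<in> T}"

definition branches :: "nat list set \<Rightarrow> (nat \<Rightarrow> nat) set" where
  "branches T = {b. \<forall>n. restr b n \<in> T}"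

definition level_tree_iso :: "(nat list \<Rightarrow> nat list) \<Rightarrow> bool" where
  "level_tree_iso \<tau> \<longleftrightarrow>
     bij \<tau> \<and> (\<forall>s. length (\<tau> s) = length s) \<and> (\<forall>s t. prefix s t \<longleftrightarrow> prefix (\<tau> s) (\<tau> t))"


section \<open>Ideals of sets\<close>

definition set_ideal :: "'a set set \<Rightarrow> bool" where
  "set_ideal I \<longleftrightarrow>
     {} \<in> I \<and> (\<forall>X\<in>I. \<forall>Y. Y \<subseteq> X \<longrightarrow> Y \<in> I) \<and> (\<forall>X\<in>I. \<forall>Y\<in>I. X \<union> Y \<in> I)"

definition Fin :: "'a set set" where
  "Fin = {X. finite X}"

definition proper_ideal :: "'a set set \<Rightarrow> bool" where
  "proper_ideal I \<longleftrightarrow> set_ideal I \<and> UNIV \<notin> I"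

text \<open>The least ideal containing the family and all finite sets; it may be improper.\<close>

definition ideal_gen :: "'a set set \<Rightarrow> 'a set set" where
  "ideal_gen F = \<Inter>{I. set_ideal I \<and> F \<union> Fin \<subseteq> I}"

definition ideals_isomorphic :: "nat set set \<Rightarrow> nat set set \<Rightarrow> bool" where
  "ideals_isomorphic I I' \<longleftrightarrow> (\<exists>\<rho>::nat \<Rightarrow> nat. bij \<rho> \<and> (\<forall>X. X \<in> I \<longleftrightarrow> \<rho> ` X \<in> I'))"


section \<open>Countable ordinals\<close>

unbundle cardinal_syntax

text \<open>The elements of \<open>omega1\<close> stand for the ordinals $\alpha < \omega_1$: the initial ordinal of
  cardinality $\aleph_1$ is realised as the cardinal successor of the order of \<^typ>\<open>nat\<close>.\<close>

typedef omega1 = "Field (cardSuc natLeq)"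
proof -
  have "infinite (Field (cardSuc natLeq))"
    using natLeq_Card_order cardSuc_finite[of natLeq] by (simp add: Field_natLeq)
  then have "Field (cardSuc natLeq) \<noteq> {}"
    by (metis finite.emptyI)
  then show "\<exists>x. x \<in> Field (cardSuc natLeq)"
    by blast
qed

lemma Well_order_cardSuc_natLeq: "Well_order (cardSuc natLeq)"
  using cardSuc_Card_order[OF natLeq_Card_order] by (simp add: card_order_on_def)

instantiation omega1 :: wellorder
begin

definition less_eq_omega1 :: "omega1 \<Rightarrow> omega1 \<Rightarrow> bool" where
  "\<alpha> \<le> \<beta> \<longleftrightarrow> (Rep_omega1 \<alpha>, Rep_omega1 \<beta>) \<in> cardSuc natLeq"

definition less_omega1 :: "omega1 \<Rightarrow> omega1 \<Rightarrow> bool" where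
  "\<alpha> < \<beta> \<longleftrightarrow> \<alpha> \<le> \<beta> \<and> \<not> \<beta> \<le> (\<alpha>::omega1)"

instance
proof
  let ?r = "cardSuc natLeq"
  have lin: "refl_on (Field ?r) ?r" "trans ?r" "antisym ?r" "total_on (Field ?r) ?r"
    and wf: "wf (?r - Id)"
    using Well_order_cardSuc_natLeq
    by (auto simp: well_order_on_def linear_order_on_def partial_order_on_def preorder_on_def)
  fix x y z :: omega1
  show "x < y \<longleftrightarrow> x \<le> y \<and> \<not> y \<le> x"
    by (simp add: less_omega1_def)
  show "x \<le> x"
    using lin(1) Rep_omega1[of x] by (simp add: less_eq_omega1_def refl_on_def)
  show "x \<le> y \<Longrightarrow> y \<le> z \<Longrightarrow> x \<le> z"
    using lin(2) by (auto simp: less_eq_omega1_def elim: transE)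
  show "x \<le> y \<Longrightarrow> y \<le> x \<Longrightarrow> x = y" for x y :: omega1
    using antisymD[OF lin(3)] by (metis less_eq_omega1_def Rep_omega1_inject)
  show "x \<le> y \<or> y \<le> x"
    using lin(1,4) Rep_omega1[of x] Rep_omega1[of y]
    unfolding less_eq_omega1_def total_on_def refl_on_def by metis
  show "P a" if step: "\<And>x. (\<And>y. y < x \<Longrightarrow> P y) \<Longrightarrow> P x" for P and a :: omega1
  proof -
    have "wf (inv_image (?r - Id) Rep_omega1)"
      using wf by (rule wf_inv_image)
    then show ?thesis
    proof (induction a rule: wf_induct_rule)
      case (less a)
      show ?case
      proof (rule step)
        fix y assume "y < a"
        then have "y \<le> a" "y \<noteq> a"
          by (auto simp: less_omega1_def)
        then show "P y"
          by (intro less) (simp add: less_eq_omega1_def Rep_omega1_inject)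
      qed
    qed
  qed
qed

end

lemma countable_iff_ordLeq_natLeq: "countable B \<longleftrightarrow> |B| \<le>o natLeq"
proof -
  have "countable B \<longleftrightarrow> |B| \<le>o |UNIV :: nat set|"
    by (simp add: countable_def flip: card_of_ordLeq)
  also have "\<dots> \<longleftrightarrow> |B| \<le>o natLeq"
    using card_of_nat ordIso_symmetric ordLeq_ordIso_trans by blast
  finally show ?thesis .
qed

lemma uncountable_omega1: "uncountable (UNIV :: omega1 set)"
proof
  assume "countable (UNIV :: omega1 set)"
  then have "countable (range Rep_omega1)"
    by (rule countable_image)
  then have "countable (Field (cardSuc natLeq))"
    by (simp add: type_definition.Rep_range[OF type_definition_omega1])
  then have "|Field (cardSuc natLeq)| \<le>o natLeq"
    by (simp add: countable_iff_ordLeq_natLeq)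
  then have "cardSuc natLeq \<le>o natLeq"
    using card_of_Field_ordIso[OF cardSuc_Card_order[OF natLeq_Card_order]]
      ordIso_symmetric ordIso_ordLeq_trans by blast
  then show False
    using cardSuc_greater[OF natLeq_Card_order] not_ordLess_ordLeq by blast
qed

lemma countable_initial_segment_omega1: "countable {..<\<alpha>::omega1}"
proof -
  have "|underS (cardSuc natLeq) (Rep_omega1 \<alpha>)| <o cardSuc natLeq"
    using cardSuc_Card_order[OF natLeq_Card_order] Rep_omega1 by (rule card_of_underS)
  then have "countable (underS (cardSuc natLeq) (Rep_omega1 \<alpha>))"
    by (simp add: countable_iff_ordLeq_natLeq cardSuc_ordLeq_ordLess[OF natLeq_Card_order]
        card_of_Card_order)
  moreover have "Rep_omega1 ` {..<\<alpha>} \<subseteq> underS (cardSuc natLeq) (Rep_omega1 \<alpha>)"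
    by (auto simp: underS_def less_le less_eq_omega1_def Rep_omega1_inject)
  ultimately have "countable (Rep_omega1 ` {..<\<alpha>})"
    by (rule countable_subset[rotated])
  then show ?thesis
    by (rule countable_image_inj_on) (simp add: inj_on_def Rep_omega1_inject)
qed


section \<open>Derived trees and the ideals\<close>

definition ideal_deriv :: "nat set set \<Rightarrow> nat list set \<Rightarrow> nat list set" where
  "ideal_deriv J T = {s \<in> T. Succ_in T s \<notin> J}"

text \<open>The three cases are $\alpha = 0$, $\alpha$ a successor (whose predecessor is the greatest
  element below it), and $\alpha$ a limit; see the lemmas following the definition.\<close>

function ideal_deriv_iter ::
    "nat set set \<Rightarrow> 'o::wellorder \<Rightarrow> nat list set \<Rightarrow> nat list set" where
  "ideal_deriv_iter J \<alpha> T =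
     (if \<forall>\<beta>. \<alpha> \<le> \<beta> then T
      else if \<exists>\<beta><\<alpha>. \<forall>\<gamma><\<alpha>. \<gamma> \<le> \<beta>
        then ideal_deriv J (ideal_deriv_iter J (GREATEST \<beta>. \<beta> < \<alpha>) T)
      else (\<Inter>\<beta>\<in>{..<\<alpha>}. ideal_deriv_iter J \<beta> T))"
  by auto
termination
proof (relation "inv_image {(\<beta>, \<alpha>). \<beta> < \<alpha>} (fst \<circ> snd)")
  show "wf (inv_image {(\<beta>, \<alpha>). \<beta> < \<alpha>} (fst \<circ> snd) ::
      ((nat set set \<times> 'o::wellorder \<times> nat list set) \<times> _) set)"
    by (intro wf_inv_image wf)
next
  fix J :: "nat set set" and \<alpha> :: "'o::wellorder" and T :: "nat list set"
  assume "\<exists>\<beta><\<alpha>. \<forall>\<gamma><\<alpha>. \<gamma> \<le> \<beta>"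
  then have "(GREATEST \<beta>. \<beta> < \<alpha>) < \<alpha>"
    by (metis GreatestI2_order)
  then show "((J, GREATEST \<beta>. \<beta> < \<alpha>, T), (J, \<alpha>, T)) \<in> inv_image {(\<beta>, \<alpha>). \<beta> < \<alpha>} (fst \<circ> snd)"
    by simp
qed simp

declare ideal_deriv_iter.simps [simp del]

lemma ideal_deriv_iter_zero:
  "(\<And>\<beta>. \<alpha> \<le> \<beta>) \<Longrightarrow> ideal_deriv_iter J \<alpha> T = T"
  by (subst ideal_deriv_iter.simps) simp

lemma ideal_deriv_iter_succ:
  fixes \<alpha> \<beta> :: "'o::wellorder"
  assumes "\<And>\<gamma>. \<gamma> < \<alpha> \<longleftrightarrow> \<gamma> \<le> \<beta>"
  shows "ideal_deriv_iter J \<alpha> T = ideal_deriv J (ideal_deriv_iter J \<beta> T)"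
proof -
  have lt: "\<beta> < \<alpha>"
    using assms by simp
  have "(GREATEST \<gamma>. \<gamma> < \<alpha>) = \<beta>"
    using assms by (intro Greatest_equality) auto
  moreover have "\<not> (\<forall>\<gamma>. \<alpha> \<le> \<gamma>)"
    using lt by (auto simp: not_le)
  moreover have "\<exists>\<beta><\<alpha>. \<forall>\<gamma><\<alpha>. \<gamma> \<le> \<beta>"
    using lt assms by blast
  ultimately show ?thesis
    by (subst ideal_deriv_iter.simps) (simp only: if_True if_False)
qed

lemma ideal_deriv_iter_limit:
  assumes "\<delta> < \<alpha>" and "\<And>\<beta>. \<beta> < \<alpha> \<Longrightarrow> \<exists>\<gamma><\<alpha>. \<beta> < \<gamma>"
  shows "ideal_deriv_iter J \<alpha> T = (\<Inter>\<beta>\<in>{..<\<alpha>}. ideal_deriv_iter J \<beta> T)"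
proof -
  have "\<not> (\<forall>\<gamma>. \<alpha> \<le> \<gamma>)" "\<not> (\<exists>\<beta><\<alpha>. \<forall>\<gamma><\<alpha>. \<gamma> \<le> \<beta>)"
    using assms by (auto simp: not_le)
  then show ?thesis
    by (subst ideal_deriv_iter.simps) (simp only: if_False)
qed

definition H_ideal :: "(nat list \<Rightarrow> nat set) \<Rightarrow> nat set set \<Rightarrow> omega1 \<Rightarrow> nat set set" where
  "H_ideal A J \<alpha> = {X. [] \<notin> ideal_deriv_iter J \<alpha> (inf_tree_of A X)}"

definition H_union :: "(nat list \<Rightarrow> nat set) \<Rightarrow> nat set set" where
  "H_union A = (\<Union>\<alpha>. H_ideal A Fin \<alpha>)"

definition G_ideal :: "(nat list \<Rightarrow> nat set) \<Rightarrow> nat \<Rightarrow> nat set set" where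
  "G_ideal A k = ideal_gen {H. \<exists>c. \<forall>x\<in>H. \<forall>y\<in>H. x \<noteq> y \<longrightarrow> Delta A x y mod k = c}"

definition C_ideal :: "(nat list \<Rightarrow> nat set) \<Rightarrow> nat set set" where
  "C_ideal A = {X. countable (branches (inf_tree_of A X))}"

definition selector :: "(nat list \<Rightarrow> nat set) \<Rightarrow> nat set \<Rightarrow> bool" where
  "selector A S \<longleftrightarrow> (\<exists>s. S \<subseteq> A s \<and> (\<forall>n. \<exists>!x. x \<in> S \<inter> A (s @ [n])))"

definition ED_ideal :: "(nat list \<Rightarrow> nat set) \<Rightarrow> nat \<Rightarrow> nat set set" where
  "ED_ideal A m = ideal_gen ({A t | t. length t = m + 1} \<union> {S. selector A S})"

text \<open>Finiteness is explicit because \<^const>\<open>card\<close> is 0 on infinite sets.\<close>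

definition PC_ideal :: "(nat list \<Rightarrow> nat set) \<Rightarrow> nat set set" where
  "PC_ideal A = ideal_gen ({S. selector A S} \<union>
     {X. \<forall>s\<in>tree_of A X.
           finite (Succ_in (tree_of A X) s) \<and> card (Succ_in (tree_of A X) s) \<le> length s + 1})"


section \<open>Quotient Boolean algebras\<close>

definition quot_rel :: "'a set set \<Rightarrow> ('a set \<times> 'a set) set" where
  "quot_rel I = {(X, Y). sym_diff X Y \<in> I}"

definition quot_class :: "'a set set \<Rightarrow> 'a set \<Rightarrow> 'a set set" where
  "quot_class I X = quot_rel I `` {X}"

definition quot :: "'a set set \<Rightarrow> 'a set set set" where
  "quot I = UNIV // quot_rel I"

text \<open>The operations are given on representatives; for an ideal \<open>I\<close> the unions below are unions of
  a single class.\<close>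

definition quot_join :: "'a set set \<Rightarrow> 'a set set \<Rightarrow> 'a set set \<Rightarrow> 'a set set" where
  "quot_join I P Q = (\<Union>X\<in>P. \<Union>Y\<in>Q. quot_class I (X \<union> Y))"

definition quot_meet :: "'a set set \<Rightarrow> 'a set set \<Rightarrow> 'a set set \<Rightarrow> 'a set set" where
  "quot_meet I P Q = (\<Union>X\<in>P. \<Union>Y\<in>Q. quot_class I (X \<inter> Y))"

definition quot_compl :: "'a set set \<Rightarrow> 'a set set \<Rightarrow> 'a set set" where
  "quot_compl I P = (\<Union>X\<in>P. quot_class I (- X))"

definition quot_iso :: "'a set set \<Rightarrow> 'b set set \<Rightarrow> ('a set set \<Rightarrow> 'b set set) \<Rightarrow> bool" where
  "quot_iso I I' \<Phi> \<longleftrightarrow>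
     bij_betw \<Phi> (quot I) (quot I') \<and>
     \<Phi> (quot_class I {}) = quot_class I' {} \<and>
     \<Phi> (quot_class I UNIV) = quot_class I' UNIV \<and>
     (\<forall>P\<in>quot I. \<forall>Q\<in>quot I. \<Phi> (quot_join I P Q) = quot_join I' (\<Phi> P) (\<Phi> Q)) \<and>
     (\<forall>P\<in>quot I. \<forall>Q\<in>quot I. \<Phi> (quot_meet I P Q) = quot_meet I' (\<Phi> P) (\<Phi> Q)) \<and>
     (\<forall>P\<in>quot I. \<Phi> (quot_compl I P) = quot_compl I' (\<Phi> P))"

definition induces_quot_iso :: "('a \<Rightarrow> 'b) \<Rightarrow> 'a set set \<Rightarrow> 'b set set \<Rightarrow> bool" where
  "induces_quot_iso \<rho> I I' \<longleftrightarrow>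
     (\<exists>\<Phi>. quot_iso I I' \<Phi> \<and> (\<forall>X. \<Phi> (quot_class I X) = quot_class I' (\<rho> ` X)))"

end

theory Submission
  imports Defs "HOL-Combinatorics.Transposition"
begin

text \<open>
  A back-and-forth argument would match the points of the two tree partitions one at a time.  No
  such bookkeeping is needed if the least points of the cells are used as guides.  Let the
  \<^emph>\<open>leading child\<close> of a node \<open>s\<close> be the one whose cell contains the least element of the cell
  of \<open>s\<close>.  Define \<open>\<tau>\<close> from the root upwards: once \<open>\<tau> s\<close> is known, the successors of \<open>s\<close> are sent
  to those of \<open>\<tau> s\<close> by the transposition that exchanges the labels of the two leading children.
  So leading children go to leading children, and every successor permutation moves at most two
  points (lemma \<open>leading_matching_exists\<close>).

  Passing to the leading child keeps the least element and passing to any other child changes it.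
  Hence two nodes have the same least element exactly when their images under \<open>\<tau>\<close> do
  (\<open>same_leader_iff\<close>), and mapping the least element of \<open>A s\<close> to that of \<open>A' (\<tau> s)\<close> is
  well defined and injective.  It is defined everywhere and onto because every point \<open>x\<close> is the
  least element of some cell: only finitely many points lie below \<open>x\<close>, and all of them are
  separated from \<open>x\<close> at some finite level (\<open>leader_exists\<close>).  A cell consists of the
  least elements of the cells at the nodes extending its own, so this map carries \<open>A s\<close> onto \<open>A' (\<tau> s)\<close>.

  Each of the ideals is defined from the cells and the tree order, and these are preserved, so the
  same bijection witnesses every isomorphism.  Only \<open>H_ideal\<close> depends on the labels of the successors,
  through the auxiliary ideal \<open>J\<close>; there the finite supports matter, because an ideal containing the
  finite sets is invariant under permutations of finite support.
\<close>


section \<open>Cells and branches\<close>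

lemma tree_partition_root: "tree_partition A \<Longrightarrow> A [] = UNIV"
  by (simp add: tree_partition_def)

lemma tree_partition_nonempty: "tree_partition A \<Longrightarrow> A s \<noteq> {}"
  unfolding tree_partition_def by (metis finite.emptyI)

lemma tree_partition_children: "tree_partition A \<Longrightarrow> (\<Union>n. A (s @ [n])) = A s"
  by (simp add: tree_partition_def)

lemma tree_partition_child_unique:
  assumes "tree_partition A" "x \<in> A (s @ [m])" "x \<in> A (s @ [n])"
  shows "m = n"
proof -
  have "disjoint_family (\<lambda>n. A (s @ [n]))"
    using assms(1) by (simp add: tree_partition_def)
  then show ?thesis
    using assms(2,3) unfolding disjoint_family_on_def by blast
qed

lemma cell_antimono:
  assumes "tree_partition A" "prefix s t"
  shows "A t \<subseteq> A s"
proof -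
  have "A (s @ u) \<subseteq> A s" for u
  proof (induction u rule: rev_induct)
    case (snoc n u)
    have "A ((s @ u) @ [n]) \<subseteq> A (s @ u)"
      using tree_partition_children[OF assms(1), of "s @ u"] by blast
    then show ?case using snoc by simp
  qed simp
  then show ?thesis using assms(2) by (metis prefixE)
qed

lemma cell_unique_at_level:
  assumes A: "tree_partition A"
  shows "length s = length t \<Longrightarrow> x \<in> A s \<Longrightarrow> x \<in> A t \<Longrightarrow> s = t"
proof (induction s arbitrary: t rule: rev_induct)
  case (snoc n s)
  obtain u m where t: "t = u @ [m]"
    using snoc.prems(1) by (cases t rule: rev_cases) auto
  have "x \<in> A s" "x \<in> A u"
    using snoc.prems(2,3) tree_partition_children[OF A] unfolding t by blast+
  then have "s = u"
    using snoc.IH snoc.prems(1) by (simp add: t)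
  then show ?case
    using tree_partition_child_unique[OF A] snoc.prems(2,3) by (simp add: t)
qed simp

lemma cells_meet_imp_comparable:
  assumes A: "tree_partition A" and x: "x \<in> A s" "x \<in> A t"
  shows "prefix s t \<or> prefix t s"
proof -
  have *: "prefix s t" if "length s \<le> length t" "x \<in> A s" "x \<in> A t" for s t
  proof -
    have "x \<in> A (take (length s) t)"
      using cell_antimono[OF A take_is_prefix] that(3) by blast
    then have "take (length s) t = s"
      using that by (intro cell_unique_at_level[OF A]) auto
    then show ?thesis by (metis take_is_prefix)
  qed
  then show ?thesis using x nat_le_linear by blast
qed

lemma restr_0 [simp]: "restr b 0 = []"
  by (simp add: restr_def)

lemma restr_Suc [simp]: "restr b (Suc n) = restr b n @ [b n]"
  by (simp add: restr_def)

lemma length_restr [simp]: "length (restr b n) = n"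
  by (simp add: restr_def)

lemma branch_exists_above:
  assumes A: "tree_partition A"
  shows "\<exists>b. \<forall>n. x \<in> A (restr b n)"
proof -
  define child where "child s = (SOME n. x \<in> A (s @ [n]))" for s
  define node where "node = rec_nat [] (\<lambda>_ s. s @ [child s])"
  have node: "node 0 = []" "node (Suc n) = node n @ [child (node n)]" for n
    by (simp_all add: node_def)
  have "restr (\<lambda>n. child (node n)) n = node n" for n
    by (induction n) (simp_all add: node)
  moreover have "x \<in> A (node n)" for n
  proof (induction n)
    case (Suc n)
    then have "\<exists>m. x \<in> A (node n @ [m])"
      using tree_partition_children[OF A] by blast
    then show ?case unfolding node child_def by (rule someI_ex)
  qed (simp add: node tree_partition_root[OF A])
  ultimately show ?thesis by metis
qed

lemma branch_unique:
  assumes A: "tree_partition A" and b: "\<And>n. x \<in> A (restr b n)" and c: "\<And>n. x \<in> A (restr c n)"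
  shows "b = c"
proof
  fix n
  have "restr b (Suc n) = restr c (Suc n)"
    using cell_unique_at_level[OF A] b c by (metis length_restr)
  then show "b n = c n" by simp
qed

lemma branch_of_eqI:
  assumes "tree_partition A" and "\<And>n. x \<in> A (restr b n)"
  shows "branch_of A x = b"
  unfolding branch_of_def using assms branch_unique[OF assms(1)] by (intro the_equality) auto

lemma branch_of_in_cell:
  assumes "tree_partition A"
  shows "x \<in> A (restr (branch_of A x) n)"
  using branch_exists_above[OF assms] branch_of_eqI[OF assms] by metis


section \<open>Least elements of cells\<close>

definition leader :: "(nat list \<Rightarrow> nat set) \<Rightarrow> nat list \<Rightarrow> nat" where
  "leader A s = (LEAST x. x \<in> A s)"

definition leading_child :: "(nat list \<Rightarrow> nat set) \<Rightarrow> nat list \<Rightarrow> nat" where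
  "leading_child A s = (THE n. leader A s \<in> A (s @ [n]))"

lemma leader_in: "tree_partition A \<Longrightarrow> leader A s \<in> A s"
  unfolding leader_def using tree_partition_nonempty by (metis LeastI_ex ex_in_conv)

lemma leader_le: "x \<in> A s \<Longrightarrow> leader A s \<le> x"
  unfolding leader_def by (rule Least_le)

lemma leading_child_iff:
  assumes "tree_partition A"
  shows "leader A s \<in> A (s @ [n]) \<longleftrightarrow> n = leading_child A s"
proof -
  have "\<exists>!n. leader A s \<in> A (s @ [n])"
    using leader_in[OF assms] tree_partition_children[OF assms]
      tree_partition_child_unique[OF assms] by blast
  then show ?thesis
    unfolding leading_child_def by (metis (mono_tags, lifting) theI')
qed

lemma leader_mono: "tree_partition A \<Longrightarrow> prefix s t \<Longrightarrow> leader A s \<le> leader A t"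
  using cell_antimono leader_in leader_le by blast

text \<open>Leaders can only grow along a branch, so keeping the leader of \<open>s\<close> until \<open>t @ [n]\<close> means
  keeping it at every single step.\<close>

lemma leader_snoc_eq_iff:
  assumes A: "tree_partition A" and st: "prefix s t"
  shows "leader A (t @ [n]) = leader A s \<longleftrightarrow> leader A t = leader A s \<and> n = leading_child A t"
proof -
  have le: "leader A s \<le> leader A t" "leader A t \<le> leader A (t @ [n])"
    using leader_mono[OF A] st by auto
  have "leader A (t @ [n]) = leader A t \<longleftrightarrow> leader A t \<in> A (t @ [n])"
    using le(2) leader_in[OF A] leader_le by (metis antisym)
  then show ?thesis
    using le leading_child_iff[OF A] by (metis antisym)
qed

lemma separation_level:
  assumes A: "tree_partition A" and "x \<noteq> y"
  shows "\<exists>k. \<forall>s. k \<le> length s \<longrightarrow> x \<in> A s \<longrightarrow> y \<notin> A s"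
proof -
  obtain u v where uv: "length u = length v" "x \<in> A u" "y \<in> A v" "A u \<noteq> A v"
    using assms unfolding tree_partition_def by metis
  show ?thesis
  proof (intro exI[of _ "length u"] allI impI notI)
    fix s assume s: "length u \<le> length s" "x \<in> A s" "y \<in> A s"
    have "A s \<subseteq> A (take (length u) s)"
      using cell_antimono[OF A take_is_prefix] .
    then have "x \<in> A (take (length u) s)" "y \<in> A (take (length u) s)"
      using s by blast+
    moreover have "length (take (length u) s) = length u"
      using s(1) by simp
    ultimately have "take (length u) s = u" "take (length u) s = v"
      using cell_unique_at_level[OF A] uv by metis+
    then show False using uv(4) by simp
  qed
qed

text \<open>The finitely many points below \<open>x\<close> have all left the cell of \<open>x\<close> at a sufficiently high level.\<close>

lemma leader_exists:
  assumes A: "tree_partition A" and x: "x \<in> A s"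
  shows "\<exists>t. prefix s t \<and> leader A t = x"
proof -
  have "\<forall>y. \<exists>k. y < x \<longrightarrow> (\<forall>t. k \<le> length t \<longrightarrow> x \<in> A t \<longrightarrow> y \<notin> A t)"
    using separation_level[OF A] by (metis less_irrefl)
  then obtain k where k: "\<And>y t. y < x \<Longrightarrow> k y \<le> length t \<Longrightarrow> x \<in> A t \<Longrightarrow> y \<notin> A t"
    by metis
  define N where "N = length s + (\<Sum>y<x. k y)"
  define t where "t = restr (branch_of A x) N"
  have t: "x \<in> A t" "length t = N"
    using branch_of_in_cell[OF A] by (simp_all add: t_def)
  have "y \<notin> A t" if "y < x" for y
  proof -
    have "k y \<le> (\<Sum>y<x. k y)"
      using that by (intro member_le_sum) auto
    then show ?thesis using k[OF that] t by (simp add: N_def)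
  qed
  then have "leader A t = x"
    using leader_in[OF A] leader_le[of x A t] t(1) by (metis le_neq_implies_less)
  moreover have "prefix s t"
    using cells_meet_imp_comparable[OF A x t(1)] prefix_length_le[of t s] t(2)
    by (auto simp: N_def intro: prefix_length_prefix)
  ultimately show ?thesis by blast
qed

lemma cell_eq_leaders:
  assumes A: "tree_partition A"
  shows "A s = leader A ` {t. prefix s t}"
  using leader_exists[OF A] leader_in[OF A] cell_antimono[OF A] by blast


section \<open>Tree maps with prescribed successor permutations\<close>

lemma level_tree_iso_if_successor_perms:
  fixes \<tau> :: "nat list \<Rightarrow> nat list" and \<pi> :: "nat list \<Rightarrow> nat \<Rightarrow> nat"
  assumes root: "\<tau> [] = []" and step: "\<And>s n. \<tau> (s @ [n]) = \<tau> s @ [\<pi> s n]"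
    and perm: "\<And>s. bij (\<pi> s)"
  shows "level_tree_iso \<tau>"
proof -
  have len: "length (\<tau> s) = length s" for s
    by (induction s rule: rev_induct) (simp_all add: root step)
  have inj: "\<tau> s = \<tau> t \<Longrightarrow> s = t" for s t
  proof (induction s arbitrary: t rule: rev_induct)
    case Nil
    then have "length t = 0"
      using len[of t] by (simp add: root)
    then show ?case by simp
  next
    case (snoc n s)
    have "length t = length (s @ [n])"
      using len snoc.prems by metis
    then obtain u m where t: "t = u @ [m]"
      by (cases t rule: rev_cases) auto
    have "\<tau> s = \<tau> u" "\<pi> s n = \<pi> u m"
      using snoc.prems by (simp_all add: t step)
    then show ?case
      using snoc.IH perm by (metis t bij_pointE)
  qed
  have surj: "\<exists>s. \<tau> s = s'" for s'
  proof (induction s' rule: rev_induct)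
    case (snoc n s')
    then obtain s where "\<tau> s = s'" by blast
    moreover obtain m where "\<pi> s m = n"
      using perm by (metis bij_pointE)
    ultimately show ?case using step by metis
  qed (use root in blast)
  have mono: "prefix (\<tau> s) (\<tau> (s @ u))" for s u
    by (induction u rule: rev_induct)
      (auto simp: step simp flip: append_assoc)
  have reflect: "prefix s t" if "prefix (\<tau> s) (\<tau> t)" for s t
  proof -
    let ?u = "take (length s) t"
    have le: "length s \<le> length t"
      using prefix_length_le[OF that] by (simp add: len)
    have "prefix (\<tau> ?u) (\<tau> t)"
      using mono[of ?u "drop (length s) t"] by simp
    then have "\<tau> ?u = \<tau> s"
      using that le len by (auto simp: prefix_def append_eq_append_conv)
    then have "?u = s" by (rule inj)
    then show ?thesis by (metis take_is_prefix)
  qed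
  show ?thesis
    unfolding level_tree_iso_def
  proof (intro conjI allI)
    show "bij \<tau>"
      using inj surj by (metis bijI injI surjI surj_def)
    show "length (\<tau> s) = length s" for s by (rule len)
    show "prefix s t \<longleftrightarrow> prefix (\<tau> s) (\<tau> t)" for s t
      using mono reflect by (metis prefixE)
  qed
qed

lemma finite_support_transpose: "finite {n. transpose a b n \<noteq> n}"
  by (rule finite_subset[of _ "{a, b}"]) (auto simp: transpose_def)

context
  fixes A A' :: "nat list \<Rightarrow> nat set"
begin

text \<open>The recursion runs along reversed nodes, since a node is extended at its end.\<close>

primrec match_rev :: "nat list \<Rightarrow> nat list" where
  "match_rev [] = []"
| "match_rev (n # r) = match_rev r @
     [transpose (leading_child A (rev r)) (leading_child A' (match_rev r)) n]"

lemma leading_matching_exists: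
  "\<exists>\<tau> \<pi>. \<tau> [] = [] \<and> (\<forall>s n. \<tau> (s @ [n]) = \<tau> s @ [\<pi> s n]) \<and>
     (\<forall>s. bij (\<pi> s) \<and> finite {n. \<pi> s n \<noteq> n} \<and>
          \<pi> s (leading_child A s) = leading_child A' (\<tau> s))"
  by (intro exI[of _ "\<lambda>s. match_rev (rev s)"]
      exI[of _ "\<lambda>s. transpose (leading_child A s) (leading_child A' (match_rev (rev s)))"])
    (auto simp: finite_support_transpose)

end


section \<open>The induced bijection of points\<close>

text \<open>An isomorphism of tree partitions.  The successor permutations \<open>\<pi>\<close> are determined by \<open>\<tau>\<close>;
  they are named because whether a set of successors lies in an ideal \<open>J\<close> depends on its labels.\<close>

locale tree_partition_iso =
  fixes A A' :: "nat list \<Rightarrow> nat set" and \<sigma> :: "nat \<Rightarrow> nat"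
    and \<tau> :: "nat list \<Rightarrow> nat list" and \<pi> :: "nat list \<Rightarrow> nat \<Rightarrow> nat"
  assumes source: "tree_partition A" and target: "tree_partition A'"
    and bij_points: "bij \<sigma>"
    and tree_iso: "level_tree_iso \<tau>"
    and image_cell: "\<sigma> ` A s = A' (\<tau> s)"
    and snoc: "\<tau> (s @ [n]) = \<tau> s @ [\<pi> s n]"
    and bij_succ: "bij (\<pi> s)"
    and finite_support: "finite {n. \<pi> s n \<noteq> n}"

context
  fixes A A' :: "nat list \<Rightarrow> nat set" and \<tau> :: "nat list \<Rightarrow> nat list"
    and \<pi> :: "nat list \<Rightarrow> nat \<Rightarrow> nat"
  assumes A: "tree_partition A" and A': "tree_partition A'"
    and iso: "level_tree_iso \<tau>"
    and step: "\<And>s n. \<tau> (s @ [n]) = \<tau> s @ [\<pi> s n]"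
    and perm: "\<And>s. bij (\<pi> s)"
    and lead: "\<And>s. \<pi> s (leading_child A s) = leading_child A' (\<tau> s)"
begin

lemma same_leader_prefix_iff:
  assumes "prefix s t"
  shows "leader A t = leader A s \<longleftrightarrow> leader A' (\<tau> t) = leader A' (\<tau> s)"
proof -
  have "leader A (s @ u) = leader A s \<longleftrightarrow> leader A' (\<tau> (s @ u)) = leader A' (\<tau> s)" for u
  proof (induction u rule: rev_induct)
    case (snoc n u)
    have "prefix (\<tau> s) (\<tau> (s @ u))"
      using iso unfolding level_tree_iso_def by (metis prefixI)
    moreover have "\<pi> (s @ u) n = leading_child A' (\<tau> (s @ u)) \<longleftrightarrow> n = leading_child A (s @ u)"
      using lead perm by (metis bij_pointE)
    ultimately show ?case
      using leader_snoc_eq_iff[OF A, of s "s @ u" n]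
        leader_snoc_eq_iff[OF A', of "\<tau> s" "\<tau> (s @ u)" "\<pi> (s @ u) n"] snoc
      by (simp add: step flip: append_assoc)
  qed simp
  then show ?thesis using assms by (metis prefixE)
qed

text \<open>Nodes with a common leader are comparable, which reduces the claim to comparable nodes.\<close>

lemma same_leader_iff:
  "leader A s = leader A t \<longleftrightarrow> leader A' (\<tau> s) = leader A' (\<tau> t)"
proof -
  have "prefix s t \<or> prefix t s" if "leader A s = leader A t"
    using cells_meet_imp_comparable[OF A, of "leader A s" s t] leader_in[OF A, of s]
      leader_in[OF A, of t] that by metis
  moreover have "prefix s t \<or> prefix t s" if "leader A' (\<tau> s) = leader A' (\<tau> t)"
    using cells_meet_imp_comparable[OF A', of "leader A' (\<tau> s)" "\<tau> s" "\<tau> t"]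
      leader_in[OF A', of "\<tau> s"] leader_in[OF A', of "\<tau> t"] that iso
    unfolding level_tree_iso_def by metis
  ultimately show ?thesis
    using same_leader_prefix_iff[of s t] same_leader_prefix_iff[of t s] by auto
qed

lemma leading_matching_induces_bijection: "\<exists>\<sigma>. bij \<sigma> \<and> (\<forall>s. \<sigma> ` A s = A' (\<tau> s))"
proof -
  have surj_leader: "\<exists>s. leader A s = x" "\<exists>s. leader A' s = x" for x
    using leader_exists[OF A, of x "[]"] leader_exists[OF A', of x "[]"]
    by (auto simp: tree_partition_root[OF A] tree_partition_root[OF A'])
  define \<sigma> where "\<sigma> x = leader A' (\<tau> (SOME s. leader A s = x))" for x
  have \<sigma>: "\<sigma> (leader A s) = leader A' (\<tau> s)" for s
    unfolding \<sigma>_def using same_leader_iff by (metis (mono_tags, lifting) someI)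
  have surj: "surj \<tau>"
    using iso by (simp add: level_tree_iso_def bij_is_surj)
  have "inj \<sigma>"
    using \<sigma> surj_leader(1) same_leader_iff by (metis injI)
  moreover have "surj \<sigma>"
    using \<sigma> surj_leader(2) surj by (metis surj_def)
  moreover have "\<sigma> ` A s = A' (\<tau> s)" for s
  proof -
    have "\<tau> ` {t. prefix s t} = {t. prefix (\<tau> s) t}"
    proof safe
      show "prefix s t \<Longrightarrow> prefix (\<tau> s) (\<tau> t)" for t
        using iso by (simp add: level_tree_iso_def)
    next
      fix t' assume "prefix (\<tau> s) t'"
      moreover obtain t where "t' = \<tau> t" using surj by blast
      ultimately show "t' \<in> \<tau> ` {t. prefix s t}"
        using iso by (simp add: level_tree_iso_def)
    qed
    then have "A' (\<tau> s) = leader A' ` \<tau> ` {t. prefix s t}"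
      using cell_eq_leaders[OF A'] by simp
    then show ?thesis
      using cell_eq_leaders[OF A] by (simp add: image_image \<sigma>)
  qed
  ultimately show ?thesis by (auto simp: bij_def)
qed

end

lemma tree_partition_iso_exists:
  assumes A: "tree_partition A" and A': "tree_partition A'"
  shows "\<exists>\<sigma> \<tau> \<pi>. tree_partition_iso A A' \<sigma> \<tau> \<pi>"
proof -
  obtain \<tau> \<pi> where matching: "\<tau> [] = [] \<and> (\<forall>s n. \<tau> (s @ [n]) = \<tau> s @ [\<pi> s n]) \<and>
      (\<forall>s. bij (\<pi> s) \<and> finite {n. \<pi> s n \<noteq> n} \<and>
           \<pi> s (leading_child A s) = leading_child A' (\<tau> s))"
    using leading_matching_exists[of A A'] by (elim exE)
  then have \<tau>: "\<tau> [] = []" "\<And>s n. \<tau> (s @ [n]) = \<tau> s @ [\<pi> s n]"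
    and \<pi>: "\<And>s. bij (\<pi> s)" "\<And>s. finite {n. \<pi> s n \<noteq> n}"
      "\<And>s. \<pi> s (leading_child A s) = leading_child A' (\<tau> s)"
    by blast+
  have iso: "level_tree_iso \<tau>"
    using \<tau> \<pi>(1) by (rule level_tree_iso_if_successor_perms)
  obtain \<sigma> where "bij \<sigma>" "\<And>s. \<sigma> ` A s = A' (\<tau> s)"
    using leading_matching_induces_bijection[of A A' \<tau> \<pi>] A A' iso \<tau>(2) \<pi>(1,3) by blast
  then have "tree_partition_iso A A' \<sigma> \<tau> \<pi>"
    using A A' iso \<tau>(2) \<pi>(1,2) by unfold_locales
  then show ?thesis by blast
qed


section \<open>Ideals and quotients under bijections\<close>

lemma set_ideal_subset: "set_ideal I \<Longrightarrow> Y \<in> I \<Longrightarrow> X \<subseteq> Y \<Longrightarrow> X \<in> I"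
  by (simp add: set_ideal_def)

lemma set_ideal_Un: "set_ideal I \<Longrightarrow> X \<in> I \<Longrightarrow> Y \<in> I \<Longrightarrow> X \<union> Y \<in> I"
  by (simp add: set_ideal_def)

lemma set_ideal_vimage_image:
  assumes I: "set_ideal I"
  shows "set_ideal {X. f ` X \<in> I}"
  unfolding set_ideal_def
proof (intro conjI ballI allI impI)
  show "{} \<in> {X. f ` X \<in> I}"
    using I by (simp add: set_ideal_def)
  show "Y \<in> {X. f ` X \<in> I}" if "X \<in> {X. f ` X \<in> I}" "Y \<subseteq> X" for X Y
    using set_ideal_subset[OF I _ image_mono[OF that(2)]] that(1) by simp
  show "X \<union> Y \<in> {X. f ` X \<in> I}" if "X \<in> {X. f ` X \<in> I}" "Y \<in> {X. f ` X \<in> I}" for X Y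
    using set_ideal_Un[OF I] that by (simp add: image_Un)
qed

lemma set_ideal_ideal_gen: "set_ideal (ideal_gen F)"
  by (auto simp: ideal_gen_def set_ideal_def)

lemma ideal_gen_image_mem:
  assumes gen: "\<And>X. X \<in> F \<Longrightarrow> f ` X \<in> F'" and X: "X \<in> ideal_gen F"
  shows "f ` X \<in> ideal_gen F'"
proof -
  have gen_sub: "F' \<union> Fin \<subseteq> ideal_gen F'"
    by (auto simp: ideal_gen_def)
  have "set_ideal {X. f ` X \<in> ideal_gen F'}"
    using set_ideal_ideal_gen by (rule set_ideal_vimage_image)
  moreover have "F \<union> Fin \<subseteq> {X. f ` X \<in> ideal_gen F'}"
    using gen gen_sub by (auto simp: Fin_def)
  ultimately show ?thesis
    using X by (auto simp: ideal_gen_def)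
qed

lemma ideal_gen_bij_iff:
  assumes f: "bij f" and gen: "\<And>X. f ` X \<in> F' \<longleftrightarrow> X \<in> F"
  shows "f ` X \<in> ideal_gen F' \<longleftrightarrow> X \<in> ideal_gen F"
proof
  have "inv f ` Y \<in> F" if "Y \<in> F'" for Y
    using that gen f by (metis bij_is_surj image_f_inv_f)
  then show "X \<in> ideal_gen F" if "f ` X \<in> ideal_gen F'"
    using ideal_gen_image_mem[of F' "inv f" F] that f by (metis bij_is_inj image_inv_f_f)
qed (use gen ideal_gen_image_mem[of F f F'] in blast)

text \<open>An ideal containing the finite sets cannot see a permutation of finite support: \<open>X\<close> and its
  image differ only inside the support.\<close>

lemma ideal_finite_support_image_iff:
  assumes J: "set_ideal J" "Fin \<subseteq> J" and p: "bij p" "finite {n. p n \<noteq> n}"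
  shows "p ` X \<in> J \<longleftrightarrow> X \<in> J"
proof -
  let ?F = "{n. p n \<noteq> n}"
  have F: "?F \<in> J"
    using J(2) p(2) by (auto simp: Fin_def)
  have "p x \<in> X \<union> ?F" if "x \<in> X" for x
    using that inj_eq[OF bij_is_inj[OF p(1)], of "p x" x] by (cases "p x = x") simp_all
  then have "p ` X \<subseteq> X \<union> ?F"
    by blast
  moreover have "x \<in> p ` X \<union> ?F" if "x \<in> X" for x
    using that imageI[of x X p] by (cases "p x = x") simp_all
  then have "X \<subseteq> p ` X \<union> ?F"
    by blast
  ultimately show ?thesis
    using set_ideal_subset[OF J(1)] set_ideal_Un[OF J(1) _ F] by blast
qed

text \<open>The quotient maps act on classes through representatives, so a bijection that matches the
  two families already induces the isomorphism, by taking images of the members of a class.\<close>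

lemma bij_induces_quot_iso:
  assumes f: "bij f" and I: "\<And>X. f ` X \<in> I' \<longleftrightarrow> X \<in> I"
  shows "induces_quot_iso f I I'"
proof -
  define \<Phi> where "\<Phi> P = image f ` P" for P
  have inj: "inj f" and surj: "surj f"
    using f by (auto simp: bij_def)
  have cls: "\<Phi> (quot_class I X) = quot_class I' (f ` X)" for X
  proof -
    have sd: "sym_diff (f ` X) (f ` Y) = f ` sym_diff X Y" for Y
      using inj by (simp add: image_Un image_set_diff)
    have "Z \<in> \<Phi> (quot_class I X)" if "Z \<in> quot_class I' (f ` X)" for Z
    proof -
      obtain Y where "Z = f ` Y" using surj by (metis image_f_inv_f)
      then show ?thesis
        using that sd I by (auto simp: \<Phi>_def quot_class_def quot_rel_def)
    qed
    then show ?thesis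
      using sd I by (auto simp: \<Phi>_def quot_class_def quot_rel_def)
  qed
  have quot: "quot L = range (quot_class L)" for L :: "'c set set"
    by (auto simp: quot_def quot_class_def quotient_def)
  have "inj \<Phi>"
    unfolding \<Phi>_def using inj by (simp add: inj_image_eq_iff inj_def)
  moreover have "\<Phi> ` quot I = quot I'"
  proof -
    have "range (\<lambda>X. quot_class I' (f ` X)) = quot_class I' ` range (image f)"
      by (simp add: image_image)
    also have "range (image f) = UNIV"
      using surj by (metis image_f_inv_f surjI)
    finally show ?thesis by (simp add: quot image_image cls)
  qed
  ultimately have "bij_betw \<Phi> (quot I) (quot I')"
    by (auto simp: bij_betw_def intro: inj_on_subset)
  moreover have Un: "\<Phi> (\<Union>X\<in>P. G X) = (\<Union>X\<in>P. \<Phi> (G X))" for P :: "'a set set" and G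
    by (auto simp: \<Phi>_def)
  have "\<Phi> (quot_join I P Q) = quot_join I' (\<Phi> P) (\<Phi> Q)" for P Q
    by (simp add: quot_join_def Un cls) (simp add: \<Phi>_def image_Un)
  moreover have "\<Phi> (quot_meet I P Q) = quot_meet I' (\<Phi> P) (\<Phi> Q)" for P Q
    by (simp add: quot_meet_def Un cls) (simp add: \<Phi>_def image_Int[OF inj])
  moreover have "\<Phi> (quot_compl I P) = quot_compl I' (\<Phi> P)" for P
    by (simp add: quot_compl_def Un cls) (simp add: \<Phi>_def bij_image_Compl_eq[OF f])
  ultimately have "quot_iso I I' \<Phi>"
    unfolding quot_iso_def using surj by (simp add: cls)
  then show ?thesis
    unfolding induces_quot_iso_def using cls by blast
qed


section \<open>Invariance of the ideals of a tree partition\<close>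

context tree_partition_iso
begin

lemma inj_points: "inj \<sigma>"
  using bij_points by (rule bij_is_inj)

lemma inj_nodes: "inj \<tau>" and surj_nodes: "surj \<tau>" and length_node: "length (\<tau> s) = length s"
  using tree_iso by (auto simp: level_tree_iso_def bij_def)

lemma root: "\<tau> [] = []"
  using length_node[of "[]"] by simp

lemma image_Int_cell: "\<sigma> ` X \<inter> A' (\<tau> s) = \<sigma> ` (X \<inter> A s)"
  by (simp add: image_Int[OF inj_points] flip: image_cell)

lemma ex_node_iff: "(\<exists>s'. P s') \<longleftrightarrow> (\<exists>s. P (\<tau> s))"
  using surj_nodes by (metis surjD)

lemma inf_tree_of_image: "inf_tree_of A' (\<sigma> ` X) = \<tau> ` inf_tree_of A X"
proof -
  have "\<tau> s \<in> inf_tree_of A' (\<sigma> ` X) \<longleftrightarrow> s \<in> inf_tree_of A X" for s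
    using finite_image_iff[OF inj_on_subset[OF inj_points]]
    by (simp add: inf_tree_of_def image_Int_cell)
  then show ?thesis
    using surj_nodes by (auto simp: image_iff) (metis surjD)
qed

lemma tree_of_image: "tree_of A' (\<sigma> ` X) = \<tau> ` tree_of A X"
proof -
  have "\<tau> s \<in> tree_of A' (\<sigma> ` X) \<longleftrightarrow> s \<in> tree_of A X" for s
    by (simp add: tree_of_def image_Int_cell)
  then show ?thesis
    using surj_nodes by (auto simp: image_iff) (metis surjD)
qed

lemma Succ_in_image: "Succ_in (\<tau> ` T) (\<tau> s) = \<pi> s ` Succ_in T s"
proof -
  have "\<pi> s n \<in> Succ_in (\<tau> ` T) (\<tau> s) \<longleftrightarrow> n \<in> Succ_in T s" for n
    using inj_nodes by (simp add: Succ_in_def inj_image_mem_iff flip: snoc)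
  then show ?thesis
    using bij_is_surj[OF bij_succ] by (auto simp: image_iff) (metis surjD)
qed

lemma ideal_deriv_image:
  assumes J: "set_ideal J" "Fin \<subseteq> J"
  shows "ideal_deriv J (\<tau> ` T) = \<tau> ` ideal_deriv J T"
proof -
  have "Succ_in (\<tau> ` T) (\<tau> s) \<notin> J \<longleftrightarrow> Succ_in T s \<notin> J" for s
    using ideal_finite_support_image_iff[OF J bij_succ finite_support]
    by (simp add: Succ_in_image)
  then show ?thesis
    by (auto simp: ideal_deriv_def)
qed

lemma ideal_deriv_iter_image:
  assumes J: "set_ideal J" "Fin \<subseteq> J"
  shows "ideal_deriv_iter J \<alpha> (\<tau> ` T) = \<tau> ` ideal_deriv_iter J \<alpha> T"
proof (induction \<alpha> rule: less_induct)
  case (less \<alpha>)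
  consider (zero) "\<And>\<beta>. \<alpha> \<le> \<beta>"
    | (succ) \<beta> where "\<And>\<gamma>. \<gamma> < \<alpha> \<longleftrightarrow> \<gamma> \<le> \<beta>"
    | (limit) \<delta> where "\<delta> < \<alpha>" "\<And>\<beta>. \<beta> < \<alpha> \<Longrightarrow> \<exists>\<gamma><\<alpha>. \<beta> < \<gamma>"
  proof (cases "\<forall>\<beta>. \<alpha> \<le> \<beta>")
    case False
    then obtain \<delta> where \<delta>: "\<delta> < \<alpha>" by (auto simp: not_le)
    show ?thesis
    proof (cases "\<forall>\<beta><\<alpha>. \<exists>\<gamma><\<alpha>. \<beta> < \<gamma>")
      case True
      then show ?thesis using limit \<delta> by blast
    next
      case False
      then obtain \<beta> where "\<beta> < \<alpha>" "\<forall>\<gamma><\<alpha>. \<not> \<beta> < \<gamma>"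
        by blast
      then have "\<gamma> < \<alpha> \<longleftrightarrow> \<gamma> \<le> \<beta>" for \<gamma>
        by (meson le_less_trans not_less)
      then show ?thesis by (rule succ)
    qed
  qed (use zero in blast)
  then show ?case
  proof cases
    case zero
    then show ?thesis by (simp add: ideal_deriv_iter_zero)
  next
    case succ
    then show ?thesis
      using less by (simp add: ideal_deriv_iter_succ[OF succ] ideal_deriv_image[OF J])
  next
    case limit
    have "(\<Inter>\<beta>\<in>{..<\<alpha>}. \<tau> ` ideal_deriv_iter J \<beta> T) = \<tau> ` (\<Inter>\<beta>\<in>{..<\<alpha>}. ideal_deriv_iter J \<beta> T)"
      using image_INT[of \<tau> UNIV "{..<\<alpha>}" "\<lambda>\<beta>. ideal_deriv_iter J \<beta> T"] inj_nodes limit(1) by blast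
    then show ?thesis
      using less by (simp add: ideal_deriv_iter_limit[OF limit])
  qed
qed

lemma H_ideal_image_iff:
  assumes J: "set_ideal J" "Fin \<subseteq> J"
  shows "\<sigma> ` X \<in> H_ideal A' J \<alpha> \<longleftrightarrow> X \<in> H_ideal A J \<alpha>"
proof -
  have "[] \<in> \<tau> ` T \<longleftrightarrow> [] \<in> T" for T
    using inj_image_mem_iff[OF inj_nodes, of "[]" T] by (simp only: root)
  then show ?thesis
    by (simp add: H_ideal_def inf_tree_of_image ideal_deriv_iter_image[OF J])
qed

lemma H_union_image_iff: "\<sigma> ` X \<in> H_union A' \<longleftrightarrow> X \<in> H_union A"
proof -
  have "set_ideal (Fin :: nat set set)"
    by (auto simp: set_ideal_def Fin_def intro: finite_subset)
  then show ?thesis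
    by (simp add: H_union_def H_ideal_image_iff)
qed

text \<open>The action of \<open>\<tau>\<close> on infinite branches.  Stating it through \<open>\<pi>\<close> gives the preservation of
  first differences: branches that agree below \<open>n\<close> have their \<open>n\<close>-th values changed by the same
  permutation.\<close>

definition branch_map :: "(nat \<Rightarrow> nat) \<Rightarrow> nat \<Rightarrow> nat" where
  "branch_map b n = \<pi> (restr b n) (b n)"

lemma restr_branch_map: "restr (branch_map b) n = \<tau> (restr b n)"
  by (induction n) (simp_all add: root snoc branch_map_def)

lemma inj_branch_map: "inj branch_map"
proof (rule injI, rule ext)
  fix b c :: "nat \<Rightarrow> nat" and n
  assume "branch_map b = branch_map c"
  then have "\<tau> (restr b (Suc n)) = \<tau> (restr c (Suc n))"
    by (metis restr_branch_map)
  then have "restr b (Suc n) = restr c (Suc n)"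
    using inj_nodes by (metis injD)
  then show "b n = c n" by simp
qed

lemma surj_branch_map: "surj branch_map"
proof -
  have "\<exists>b. branch_map b = b'" for b'
  proof -
    define node where "node n = inv \<tau> (restr b' n)" for n
    have node: "\<tau> (node n) = restr b' n" for n
      using surj_nodes by (simp add: node_def surj_f_inv_f)
    have node_Suc: "\<exists>k. node (Suc n) = node n @ [k] \<and> \<pi> (node n) k = b' n" for n
    proof -
      obtain k where k: "\<pi> (node n) k = b' n"
        using bij_succ by (metis bij_pointE)
      then have "\<tau> (node n @ [k]) = \<tau> (node (Suc n))"
        by (simp add: snoc node)
      then show ?thesis using k inj_nodes by (metis injD)
    qed
    define b where "b n = last (node (Suc n))" for n
    have b: "node (Suc n) = node n @ [b n]" "\<pi> (node n) (b n) = b' n" for n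
      using node_Suc[of n] by (auto simp: b_def)
    have "node 0 = []"
      using length_node[of "node 0"] by (simp add: node)
    then have "restr b n = node n" for n
      by (induction n) (simp_all add: b(1))
    then have "branch_map b = b'"
      by (simp add: fun_eq_iff branch_map_def b(2))
    then show ?thesis by blast
  qed
  then show ?thesis by (metis surjI)
qed

lemma C_ideal_image_iff: "\<sigma> ` X \<in> C_ideal A' \<longleftrightarrow> X \<in> C_ideal A"
proof -
  let ?T = "inf_tree_of A X"
  have "branch_map b \<in> branches (\<tau> ` ?T) \<longleftrightarrow> b \<in> branches ?T" for b
    by (simp add: branches_def restr_branch_map inj_image_mem_iff[OF inj_nodes])
  then have "branches (\<tau> ` ?T) = branch_map ` branches ?T"
    using surj_branch_map by (auto simp: image_iff) (metis surjD)
  then show ?thesis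
    using countable_image_inj_eq[OF inj_on_subset[OF inj_branch_map]]
    by (simp add: C_ideal_def inf_tree_of_image)
qed

lemma branch_of_image: "branch_of A' (\<sigma> x) = branch_map (branch_of A x)"
proof (rule branch_of_eqI[OF target])
  show "\<sigma> x \<in> A' (restr (branch_map (branch_of A x)) n)" for n
    unfolding restr_branch_map image_cell[symmetric]
    using branch_of_in_cell[OF source] by (rule imageI)
qed

lemma first_difference_branch_map:
  "(LEAST n. branch_map b n \<noteq> branch_map c n) = (LEAST n. b n \<noteq> c n)"
proof (cases "b = c")
  case False
  define d where "d = (LEAST n. b n \<noteq> c n)"
  have "\<exists>n. b n \<noteq> c n"
    using False by (simp add: fun_eq_iff)
  then have d: "b d \<noteq> c d"
    unfolding d_def by (rule LeastI_ex)
  have below: "b n = c n" if "n < d" for n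
    using not_less_Least[of n "\<lambda>n. b n \<noteq> c n"] that by (simp add: d_def)
  have restr: "restr b n = restr c n" if "n \<le> d" for n
    using that below by (simp add: restr_def)
  have "(LEAST n. branch_map b n \<noteq> branch_map c n) = d"
  proof (rule Least_equality)
    show "branch_map b d \<noteq> branch_map c d"
      using d restr[of d] inj_eq[OF bij_is_inj[OF bij_succ]] by (simp add: branch_map_def)
    show "d \<le> n" if "branch_map b n \<noteq> branch_map c n" for n
    proof (rule ccontr)
      assume "\<not> d \<le> n"
      then show False
        using that below[of n] restr[of n] by (simp add: branch_map_def)
    qed
  qed
  then show ?thesis by (simp add: d_def)
qed simp

lemma Delta_image: "Delta A' (\<sigma> x) (\<sigma> y) = Delta A x y"
  by (simp add: Delta_def branch_of_image first_difference_branch_map)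

lemma G_ideal_image_iff: "\<sigma> ` X \<in> G_ideal A' k \<longleftrightarrow> X \<in> G_ideal A k"
  unfolding G_ideal_def
  by (intro ideal_gen_bij_iff[OF bij_points])
    (simp add: Delta_image inj_eq[OF inj_points])

lemma selector_image_iff: "selector A' (\<sigma> ` S) \<longleftrightarrow> selector A S"
proof -
  have ex1: "(\<exists>!y. y \<in> \<sigma> ` Z) \<longleftrightarrow> (\<exists>!x. x \<in> Z)" for Z
    using inj_points by (auto dest: injD)
  have all: "(\<forall>n. P n) \<longleftrightarrow> (\<forall>n. P (\<pi> s n))" for P s
    using bij_succ by (metis bij_pointE)
  have "(\<forall>n. \<exists>!y. y \<in> \<sigma> ` S \<inter> A' (\<tau> s @ [n])) \<longleftrightarrow> (\<forall>n. \<exists>!x. x \<in> S \<inter> A (s @ [n]))" for s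
    by (subst all[of _ s]) (simp only: image_Int_cell ex1 flip: snoc)
  moreover have "\<sigma> ` S \<subseteq> A' (\<tau> s) \<longleftrightarrow> S \<subseteq> A s" for s
    by (simp add: inj_image_subset_iff[OF inj_points] flip: image_cell)
  ultimately show ?thesis
    unfolding selector_def by (subst ex_node_iff) simp
qed

lemma ED_ideal_image_iff: "\<sigma> ` X \<in> ED_ideal A' m \<longleftrightarrow> X \<in> ED_ideal A m"
proof -
  have "(\<exists>t. \<sigma> ` X = A' t \<and> length t = m + 1) \<longleftrightarrow> (\<exists>t. X = A t \<and> length t = m + 1)" for X
    by (subst ex_node_iff)
      (simp add: length_node inj_image_eq_iff[OF inj_points] flip: image_cell)
  then show ?thesis
    unfolding ED_ideal_def
    by (intro ideal_gen_bij_iff[OF bij_points]) (simp add: selector_image_iff)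
qed

lemma PC_ideal_image_iff: "\<sigma> ` X \<in> PC_ideal A' \<longleftrightarrow> X \<in> PC_ideal A"
proof -
  have inj: "inj_on (\<pi> s) N" for s N
    using bij_is_inj[OF bij_succ] by (rule inj_on_subset) simp
  show ?thesis
    unfolding PC_ideal_def
    by (intro ideal_gen_bij_iff[OF bij_points])
      (simp add: selector_image_iff tree_of_image Succ_in_image length_node
        finite_image_iff[OF inj] card_image[OF inj])
qed

lemma ideals_isomorphicI:
  "(\<And>X. \<sigma> ` X \<in> I' \<longleftrightarrow> X \<in> I) \<Longrightarrow> ideals_isomorphic I I'"
  unfolding ideals_isomorphic_def using bij_points by blast

end

theorem proposition2p4:
  fixes A A' :: "nat list \<Rightarrow> nat set"
  assumes "tree_partition A" and "tree_partition A'"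
  shows "(\<exists>(\<sigma>::nat \<Rightarrow> nat) \<tau>. bij \<sigma> \<and> level_tree_iso \<tau> \<and> (\<forall>s. \<sigma> ` A s = A' (\<tau> s)) \<and>
            (\<forall>t. \<exists>\<pi>::nat \<Rightarrow> nat. bij \<pi> \<and> (\<forall>n. \<tau> (t @ [n]) = \<tau> t @ [\<pi> n]) \<and>
                  finite {n. \<pi> n \<noteq> n})) \<and>
         (\<forall>J \<alpha>. proper_ideal J \<and> Fin \<subseteq> J \<longrightarrow>
            ideals_isomorphic (H_ideal A J \<alpha>) (H_ideal A' J \<alpha>)) \<and>
         (\<forall>k\<ge>2. ideals_isomorphic (G_ideal A k) (G_ideal A' k)) \<and>
         ideals_isomorphic (C_ideal A) (C_ideal A') \<and>
         ideals_isomorphic (PC_ideal A) (PC_ideal A') \<and>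
         (\<forall>m. ideals_isomorphic (ED_ideal A m) (ED_ideal A' m)) \<and>
         (\<exists>\<rho>::nat \<Rightarrow> nat. bij \<rho> \<and> induces_quot_iso \<rho> (H_union A) (H_union A'))"
proof -
  obtain \<sigma> \<tau> \<pi> where "tree_partition_iso A A' \<sigma> \<tau> \<pi>"
    using tree_partition_iso_exists[OF assms] by blast
  then interpret tree_partition_iso A A' \<sigma> \<tau> \<pi> .
  have succ: "\<exists>p. bij p \<and> (\<forall>n. \<tau> (t @ [n]) = \<tau> t @ [p n]) \<and> finite {n. p n \<noteq> n}" for t
    by (intro exI[of _ "\<pi> t"] conjI allI snoc bij_succ finite_support)
  show ?thesis
  proof (intro conjI allI impI)
    show "\<exists>(\<sigma>::nat \<Rightarrow> nat) \<tau>. bij \<sigma> \<and> level_tree_iso \<tau> \<and> (\<forall>s. \<sigma> ` A s = A' (\<tau> s)) \<and>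
            (\<forall>t. \<exists>\<pi>::nat \<Rightarrow> nat. bij \<pi> \<and> (\<forall>n. \<tau> (t @ [n]) = \<tau> t @ [\<pi> n]) \<and>
                  finite {n. \<pi> n \<noteq> n})"
      by (intro exI[of _ \<sigma>] exI[of _ \<tau>] conjI bij_points tree_iso allI image_cell succ)
    show "ideals_isomorphic (H_ideal A J \<alpha>) (H_ideal A' J \<alpha>)" if "proper_ideal J \<and> Fin \<subseteq> J" for J \<alpha>
      using that by (intro ideals_isomorphicI H_ideal_image_iff) (simp_all add: proper_ideal_def)
    show "\<exists>\<rho>::nat \<Rightarrow> nat. bij \<rho> \<and> induces_quot_iso \<rho> (H_union A) (H_union A')"
      using bij_points bij_induces_quot_iso[OF bij_points H_union_image_iff] by blast
  qed (intro ideals_isomorphicI G_ideal_image_iff C_ideal_image_iff PC_ideal_image_iff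
      ED_ideal_image_iff)+
qed

end
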